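(* If $(\omega,J)$ is a special Lagrangian structure on a semi-direct product $\mathfrak h=\mathfrak g\ltimes_\rho V$, then $(\omega_J,J_\omega)$ is a special Lagrangian structure on the dual semi-direct product $\mathfrak h^\vee=\mathfrak g\ltimes_{\rho^*}V^*$.
   Context: All Lie algebras are finite dimensional and real. For a representation $\rho:\mathfrak g\to\mathrm{End}(V)$, $\mathfrak g\ltimes_\rho V$ is $\mathfrak g\oplus V$ with bracket $[x+u,y+v]=[x,y]+\rho(x)v-\rho(y)u$. The dual semi-direct product is $\mathfrak g\ltimes_{\rho^*}V^*$ with $(\rho^*(x)a)(u)=-a(\rho(x)u)$. A complex structure $J$ ($J^2=-1$) is integrable if $[x,y]-[Jx,Jy]+J([x,Jy]+[Jx,y])=0$ for all $x,y$. A pseudo-Kähler structure on a Lie algebra is a pair $(\omega,J)$ with $\omega$ symplectic (non-degenerate and closed for the Chevalley-Eilenberg differential), $J$ an integrable complex structure, and $\omega(J\xi,J\eta)=\omega(\xi,\eta)$ for all $\xi,\eta$. A special Lagrangian structure on a semi-direct product $\mathfrak g\ltimes_\rho V$ is a pseudo-Kähler structure $(\omega,J)$ such that $J\mathfrak g=V$ and both $\mathfrak g$ and $V$ are Lagrangian for $\omega$. For such a structure, on $\mathfrak h^\vee=\mathfrak g\oplus V^*$ define, for $x,y\in\mathfrak g$, $u,v\in V^*$, $$\omega_J(x+u,y+v)=v(Jx)-u(Jy),\qquad J_\omega(x+u)=-\omega^{-1}(u)+\omega(x),$$ where $\omega(x)=\omega(x,\cdot)|_V$ gives the isomorphism $\omega:\mathfrak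 g\to V^*$. *)

theory Defs
  imports "HOL-Analysis.Analysis"
begin

text \<open>
  A real vector space is a type of class \<^class>\<open>real_vector\<close>; the zero space is allowed, which is why
  class \<^class>\<open>euclidean_space\<close> is not used. The summands of a space of product type are
  identified with \<^term>\<open>UNIV \<times> {0}\<close> and \<^term>\<open>{0} \<times> UNIV\<close>.
\<close>

definition finite_dim :: "'a::real_vector itself \<Rightarrow> bool" where
  "finite_dim _ \<longleftrightarrow> (\<exists>B::'a set. finite B \<and> span B = UNIV)"

typedef (overloaded) 'v dual_space = "{f :: 'v::real_vector \<Rightarrow> real. linear f}"
  morphisms dual_apply Dual
  using linear_zero by blast

setup_lifting type_definition_dual_space

instantiation dual_space :: (real_vector) real_vector
begin

lift_definition zero_dual_space :: "'a dual_space" is "\<lambda>_. 0"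
  by (auto intro: linearI)

lift_definition plus_dual_space :: "'a dual_space \<Rightarrow> 'a dual_space \<Rightarrow> 'a dual_space"
  is "\<lambda>f g u. f u + g u"
  by (simp add: linear_compose_add)

lift_definition uminus_dual_space :: "'a dual_space \<Rightarrow> 'a dual_space"
  is "\<lambda>f u. - f u"
  by (simp add: linear_compose_neg)

lift_definition minus_dual_space :: "'a dual_space \<Rightarrow> 'a dual_space \<Rightarrow> 'a dual_space"
  is "\<lambda>f g u. f u - g u"
  by (simp add: linear_compose_sub)

lift_definition scaleR_dual_space :: "real \<Rightarrow> 'a dual_space \<Rightarrow> 'a dual_space"
  is "\<lambda>c f u. c *\<^sub>R f u"
  by (rule linear_compose_scale_right)

instance
  by standard (transfer; auto simp: algebra_simps)+

end

locale lie_algebra =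
  fixes br :: "'a::real_vector \<Rightarrow> 'a \<Rightarrow> 'a"
  assumes finite_dim: "finite_dim TYPE('a)"
    and bilinear: "bilinear br"
    and alternating: "br x x = 0"
    and jacobi: "br x (br y z) + br y (br z x) + br z (br x y) = 0"

locale lie_representation = lie_algebra br
  for br :: "'g::real_vector \<Rightarrow> 'g \<Rightarrow> 'g" +
  fixes \<rho> :: "'g \<Rightarrow> 'v::real_vector \<Rightarrow> 'v"
  assumes rep_finite_dim: "finite_dim TYPE('v)"
    and rep_bilinear: "bilinear \<rho>"
    and rep_bracket: "\<rho> (br x y) u = \<rho> x (\<rho> y u) - \<rho> y (\<rho> x u)"

definition semidirect ::
  "('g::real_vector \<Rightarrow> 'g \<Rightarrow> 'g) \<Rightarrow> ('g \<Rightarrow> 'v::real_vector \<Rightarrow> 'v) \<Rightarrow> 'g \<times> 'v \<Rightarrow> 'g \<times> 'v \<Rightarrow> 'g \<times> 'v"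
  where "semidirect br \<rho> = (\<lambda>(x, u) (y, v). (br x y, \<rho> x v - \<rho> y u))"

text \<open>
  The functions below that use \<^const>\<open>Dual\<close> are meaningful only when its argument is a linear
  functional, which holds whenever \<open>\<rho>\<close> is a representation and \<open>\<omega>\<close> is bilinear, respectively.
\<close>

definition dual_rep ::
  "('g \<Rightarrow> 'v::real_vector \<Rightarrow> 'v) \<Rightarrow> 'g \<Rightarrow> 'v dual_space \<Rightarrow> 'v dual_space"
  where "dual_rep \<rho> x a = Dual (\<lambda>u. - dual_apply a (\<rho> x u))"

text \<open>The Chevalley-Eilenberg differential of a 2-form, with trivial real coefficients.\<close>

definition ce_differential ::
  "('a \<Rightarrow> 'a \<Rightarrow> 'a) \<Rightarrow> ('a \<Rightarrow> 'a \<Rightarrow> real) \<Rightarrow> 'a \<Rightarrow> 'a \<Rightarrow> 'a \<Rightarrow> real"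
  where "ce_differential br \<omega> x y z = - \<omega> (br x y) z + \<omega> (br x z) y - \<omega> (br y z) x"

locale symplectic_lie_algebra = lie_algebra br
  for br :: "'a::real_vector \<Rightarrow> 'a \<Rightarrow> 'a" +
  fixes \<omega> :: "'a \<Rightarrow> 'a \<Rightarrow> real"
  assumes form_bilinear: "bilinear \<omega>"
    and form_alternating: "\<omega> x x = 0"
    and nondegenerate: "(\<And>y. \<omega> x y = 0) \<Longrightarrow> x = 0"
    and closed: "ce_differential br \<omega> x y z = 0"

locale complex_lie_algebra = lie_algebra br
  for br :: "'a::real_vector \<Rightarrow> 'a \<Rightarrow> 'a" +
  fixes J :: "'a \<Rightarrow> 'a"
  assumes J_linear: "linear J"
    and J_square: "J (J x) = - x"
    and integrable: "br x y - br (J x) (J y) + J (br x (J y) + br (J x) y) = 0"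

locale pseudo_kaehler = symplectic_lie_algebra br \<omega> + complex_lie_algebra br J
  for br :: "'a::real_vector \<Rightarrow> 'a \<Rightarrow> 'a" and \<omega> :: "'a \<Rightarrow> 'a \<Rightarrow> real" and J :: "'a \<Rightarrow> 'a" +
  assumes compatible: "\<omega> (J x) (J y) = \<omega> x y"

definition lagrangian :: "('a::real_vector \<Rightarrow> 'a \<Rightarrow> real) \<Rightarrow> 'a set \<Rightarrow> bool" where
  "lagrangian \<omega> W \<longleftrightarrow> subspace W \<and> W = {x. \<forall>w\<in>W. \<omega> x w = 0}"

locale special_lagrangian =
  lie_representation br \<rho> + total: pseudo_kaehler "semidirect br \<rho>" \<omega> J
  for br :: "'g::real_vector \<Rightarrow> 'g \<Rightarrow> 'g" and \<rho> :: "'g \<Rightarrow> 'v::real_vector \<Rightarrow> 'v"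
    and \<omega> :: "'g \<times> 'v \<Rightarrow> 'g \<times> 'v \<Rightarrow> real" and J :: "'g \<times> 'v \<Rightarrow> 'g \<times> 'v" +
  assumes J_image: "J ` (UNIV \<times> {0}) = {0} \<times> UNIV"
    and lagrangian_base: "lagrangian \<omega> (UNIV \<times> {0})"
    and lagrangian_fibre: "lagrangian \<omega> ({0} \<times> UNIV)"

definition form_map ::
  "('g::real_vector \<times> 'v::real_vector \<Rightarrow> 'g \<times> 'v \<Rightarrow> real) \<Rightarrow> 'g \<Rightarrow> 'v dual_space"
  where "form_map \<omega> x = Dual (\<lambda>v. \<omega> (x, 0) (0, v))"

text \<open>
  In \<open>omega_J\<close>, \<^term>\<open>snd (J (x, 0))\<close> is \<open>Jx\<close> as an element of \<open>V\<close>; in \<open>J_omega\<close>, \<^const>\<open>inv\<close> is a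
  genuine inverse when \<open>\<omega>\<close> belongs to a special Lagrangian structure.
\<close>

definition omega_J ::
  "('g::real_vector \<times> 'v::real_vector \<Rightarrow> 'g \<times> 'v) \<Rightarrow> 'g \<times> 'v dual_space \<Rightarrow> 'g \<times> 'v dual_space \<Rightarrow> real"
  where "omega_J J = (\<lambda>(x, u) (y, v). dual_apply v (snd (J (x, 0))) - dual_apply u (snd (J (y, 0))))"

definition J_omega ::
  "('g::real_vector \<times> 'v::real_vector \<Rightarrow> 'g \<times> 'v \<Rightarrow> real) \<Rightarrow> 'g \<times> 'v dual_space \<Rightarrow> 'g \<times> 'v dual_space"
  where "J_omega \<omega> = (\<lambda>(x, u). (- inv (form_map \<omega>) u, form_map \<omega> x))"

end

theory Submission
  imports Defs
begin

text \<open>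
  A special Lagrangian structure amounts to an isomorphism \<open>j : \<gg> \<rightarrow> V\<close> and a non-degenerate pairing
  \<open>W\<close> of \<open>\<gg>\<close> with \<open>V\<close>, that is an isomorphism \<open>m : \<gg> \<rightarrow> V\<^sup>*\<close>. Integrability of \<open>J\<close> says that \<open>j\<close> is
  a 1-cocycle with values in \<open>\<rho>\<close>, closedness of \<open>\<omega>\<close> says that \<open>m\<close> is a 1-cocycle with values in
  \<open>\<rho>\<^sup>*\<close>, and compatibility says that \<open>W x (j y)\<close> is symmetric. Passing to the dual exchanges the
  cocycles \<open>j\<close> and \<open>m\<close> and preserves these conditions.
\<close>

section \<open>Finite-dimensional linear algebra\<close>

lemma finite_dim_prod:
  assumes "finite_dim TYPE('a::real_vector)" "finite_dim TYPE('b::real_vector)"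
  shows "finite_dim TYPE('a \<times> 'b)"
proof -
  obtain A :: "'a set" and B :: "'b set"
    where A: "finite A" "span A = UNIV" and B: "finite B" "span B = UNIV"
    using assms by (auto simp: finite_dim_def)
  let ?C = "(\<lambda>a. (a, 0)) ` A \<union> (\<lambda>b. (0, b)) ` B"
  have lin: "linear (\<lambda>a. (a :: 'a, 0 :: 'b))" "linear (\<lambda>b. (0 :: 'a, b :: 'b))"
    by (auto intro!: linearI)
  have "(a, b) \<in> span ?C" for a b
  proof -
    have "(a, 0) \<in> span ?C"
      using linear_span_image[OF lin(1), of A] A(2) span_mono[of "(\<lambda>a. (a, 0)) ` A" ?C] by auto
    moreover have "(0, b) \<in> span ?C"
      using linear_span_image[OF lin(2), of B] B(2) span_mono[of "(\<lambda>b. (0, b)) ` B" ?C] by auto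
    ultimately show ?thesis
      using span_add by fastforce
  qed
  then have "span ?C = UNIV" by auto
  then show ?thesis
    unfolding finite_dim_def using A(1) B(1) by (intro exI[of _ ?C]) simp
qed

text \<open>This is how the dual space is later seen to be finite dimensional: it is the image of
  the Lie algebra under \<open>form_map \<omega>\<close>.\<close>

lemma finite_dim_linear_surj:
  fixes f :: "'a::real_vector \<Rightarrow> 'b::real_vector"
  assumes "finite_dim TYPE('a)" "linear f" "surj f"
  shows "finite_dim TYPE('b)"
proof -
  obtain A :: "'a set" where A: "finite A" "span A = UNIV"
    using assms(1) by (auto simp: finite_dim_def)
  then have "span (f ` A) = UNIV"
    using linear_span_image[OF assms(2), of A] assms(3) by simp
  then show ?thesis
    unfolding finite_dim_def using A(1) by blast
qed

lemma finite_dim_basis: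
  assumes "finite_dim TYPE('a::real_vector)"
  obtains B :: "'a::real_vector set" where "finite B" "independent B" "span B = UNIV"
proof -
  obtain A :: "'a set" where A: "finite A" "span A = UNIV"
    using assms by (auto simp: finite_dim_def)
  obtain B where "B \<subseteq> A" "independent B" "A \<subseteq> span B"
    by (rule maximal_independent_subset)
  then have "finite B" "span B = UNIV"
    using A finite_subset span_minimal[of A "span B"] by auto
  then show thesis
    using \<open>independent B\<close> that by blast
qed

text \<open>Sending \<open>x\<close> to the vector whose coordinates are the values
  \<open>b x e\<close> on a basis is linear, and injective by non-degeneracy; in finite dimension it
  is then surjective, so the values of \<open>f\<close> on the basis are attained.\<close>

lemma nondegenerate_form_represents:
  fixes b :: "'a::real_vector \<Rightarrow> 'a \<Rightarrow> real"
  assumes fin: "finite_dim TYPE('a)" and bil: "bilinear b"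
    and nondeg: "\<And>x. (\<And>y. b x y = 0) \<Longrightarrow> x = 0"
    and "linear f"
  obtains x where "\<And>y. b x y = f y"
proof -
  obtain B :: "'a set" where B: "finite B" "independent B" "span B = UNIV"
    using finite_dim_basis[OF fin] .
  \<comment> \<open>Taking the chosen basis as the basis of the locale makes the implication from
    injective to surjective available without a type class of finite dimension.\<close>
  interpret B: finite_dimensional_vector_space "scaleR :: real \<Rightarrow> 'a \<Rightarrow> 'a" B
    using B by unfold_locales (auto simp: dependent_raw_def span_raw_def)
  have right: "linear (b x)" and left: "linear (\<lambda>x. b x y)" for x y
    using bil by (auto simp: bilinear_def)
  have eqI: "g = h" if "linear g" "linear h" "\<And>e. e \<in> B \<Longrightarrow> g e = h e" for g h :: "'a \<Rightarrow> real"
    using linear_eq_on_span[OF that(1,2), of B] that(3) B(3) by auto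
  define T where "T x = (\<Sum>e\<in>B. b x e *\<^sub>R e)" for x
  have "linear T"
    unfolding T_def by (intro linear_compose_sum ballI linearI)
      (simp_all add: linear_add[OF left] linear_scale[OF left] scaleR_left_distrib)
  have coeff: "c e = d e" if "(\<Sum>e\<in>B. c e *\<^sub>R e) = (\<Sum>e\<in>B. d e *\<^sub>R e)" "e \<in> B" for c d e
    using independentD[OF B(2,1) subset_refl, of "\<lambda>e. c e - d e"] that
    by (simp add: scaleR_left_diff_distrib sum_subtractf)
  have "inj T"
    unfolding linear_injective_0[OF \<open>linear T\<close>]
  proof (intro allI impI)
    fix x assume "T x = 0"
    then have "b x e = 0" if "e \<in> B" for e
      using coeff[of "b x" "\<lambda>_. 0"] that by (simp add: T_def)
    then have "b x = (\<lambda>_. 0)"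
      by (intro eqI right linear_zero)
    then show "x = 0" by (intro nondeg) simp
  qed
  then have "surj T"
    using \<open>linear T\<close> by (intro B.linear_inj_imp_surj) (auto simp: linear_def)
  then obtain x where "T x = (\<Sum>e\<in>B. f e *\<^sub>R e)"
    by (metis surjD)
  then have "b x = f"
    unfolding T_def by (intro eqI right \<open>linear f\<close> coeff)
  then show thesis by (intro that[of x]) simp
qed

section \<open>Evaluation of functionals\<close>

lemma dual_apply_linear: "linear (dual_apply a)"
  using dual_apply by auto

lemma dual_apply_Dual: "linear f \<Longrightarrow> dual_apply (Dual f) = f"
  by (simp add: Dual_inverse)

lemma dual_eqI: "(\<And>u. dual_apply a u = dual_apply b u) \<Longrightarrow> a = b"
  by (metis dual_apply_inject ext)

lemmas dual_apply_simps =
  zero_dual_space.rep_eq plus_dual_space.rep_eq uminus_dual_space.rep_eq minus_dual_space.rep_eq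
  scaleR_dual_space.rep_eq

section \<open>Semi-direct products and dual representations\<close>

context lie_representation
begin

lemmas bilinear_simps =
  bilinear_ladd[OF bilinear] bilinear_radd[OF bilinear] bilinear_lneg[OF bilinear]
  bilinear_rneg[OF bilinear] bilinear_lsub[OF bilinear] bilinear_rsub[OF bilinear]
  bilinear_lmul[OF bilinear] bilinear_rmul[OF bilinear]
  bilinear_lzero[OF bilinear] bilinear_rzero[OF bilinear]
  bilinear_ladd[OF rep_bilinear] bilinear_radd[OF rep_bilinear] bilinear_lneg[OF rep_bilinear]
  bilinear_rneg[OF rep_bilinear] bilinear_lsub[OF rep_bilinear] bilinear_rsub[OF rep_bilinear]
  bilinear_lmul[OF rep_bilinear] bilinear_rmul[OF rep_bilinear]
  bilinear_lzero[OF rep_bilinear] bilinear_rzero[OF rep_bilinear]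

lemma lie_algebra_semidirect: "lie_algebra (semidirect br \<rho>)"
proof
  show "finite_dim TYPE('g \<times> 'v)"
    by (rule finite_dim_prod[OF finite_dim rep_finite_dim])
  show "bilinear (semidirect br \<rho>)"
    unfolding bilinear_def
    by (auto intro!: linearI simp: semidirect_def bilinear_simps algebra_simps)
  show "semidirect br \<rho> x x = 0" for x
    by (cases x) (simp add: semidirect_def alternating zero_prod_def)
  show "semidirect br \<rho> x (semidirect br \<rho> y z) + semidirect br \<rho> y (semidirect br \<rho> z x)
      + semidirect br \<rho> z (semidirect br \<rho> x y) = 0" for x y z
    by (cases x; cases y; cases z)
      (simp add: semidirect_def jacobi rep_bracket bilinear_simps zero_prod_def)
qed

lemma dual_rep_apply: "dual_apply (dual_rep \<rho> x a) u = - dual_apply a (\<rho> x u)"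
proof -
  have "linear (\<lambda>u. - dual_apply a (\<rho> x u))"
    by (rule linearI) (simp_all add: bilinear_simps linear_add[OF dual_apply_linear]
        linear_scale[OF dual_apply_linear])
  then show ?thesis
    by (simp add: dual_rep_def dual_apply_Dual)
qed

text \<open>Finite dimension of the dual is left as a hypothesis, to be discharged from the
  surjectivity of \<open>form_map \<omega>\<close>.\<close>

lemma dual_lie_representation:
  assumes "finite_dim TYPE('v dual_space)"
  shows "lie_representation br (dual_rep \<rho>)"
proof
  note dual_lin = linear_add[OF dual_apply_linear] linear_diff[OF dual_apply_linear]
    linear_scale[OF dual_apply_linear]
  show "finite_dim TYPE('v dual_space)" by fact
  show "bilinear (dual_rep \<rho>)"
    unfolding bilinear_def
    by (intro conjI allI linearI dual_eqI)
      (simp_all add: dual_rep_apply dual_apply_simps bilinear_simps dual_lin)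
  show "dual_rep \<rho> (br x y) a = dual_rep \<rho> x (dual_rep \<rho> y a) - dual_rep \<rho> y (dual_rep \<rho> x a)"
    for x y a
    by (rule dual_eqI) (simp add: dual_rep_apply dual_apply_simps rep_bracket dual_lin)
qed

text \<open>On the fibre, J must be \<open>- inv j\<close> because its square is -1, and the form
  has only mixed terms because both summands are isotropic. The representation, \<open>j\<close> and
  \<open>W\<close> are kept abstract so that the result applies to the dual representation.\<close>

lemma special_lagrangianI:
  fixes j :: "'g \<Rightarrow> 'v" and W :: "'g \<Rightarrow> 'v \<Rightarrow> real"
  assumes j: "linear j" "bij j" and W: "bilinear W"
    and sym: "\<And>x y. W x (j y) = W y (j x)"
    and nondeg: "\<And>x. (\<And>v. W x v = 0) \<Longrightarrow> x = 0"
    and j_cocycle: "\<And>x y. j (br x y) = \<rho> x (j y) - \<rho> y (j x)"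
    and W_cocycle: "\<And>x y u. W (br x y) u = W x (\<rho> y u) - W y (\<rho> x u)"
  shows "special_lagrangian br \<rho> (\<lambda>(x, u) (y, v). W x v - W y u) (\<lambda>(x, u). (- inv j u, j x))"
proof -
  let ?br = "semidirect br \<rho>"
  let ?\<omega> = "\<lambda>(x, u) (y, v). W x v - W y u"
  let ?J = "\<lambda>(x, u). (- inv j u, j x)"
  note W_simps = bilinear_ladd[OF W] bilinear_radd[OF W] bilinear_lneg[OF W] bilinear_rneg[OF W]
    bilinear_lsub[OF W] bilinear_rsub[OF W] bilinear_lmul[OF W] bilinear_rmul[OF W]
    bilinear_lzero[OF W] bilinear_rzero[OF W]
  note j_simps = linear_add[OF j(1)] linear_diff[OF j(1)] linear_neg[OF j(1)]
    linear_scale[OF j(1)] linear_0[OF j(1)]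
  have inv_j [simp]: "inv j (j x) = x" and j_inv [simp]: "j (inv j u) = u" for x u
    using j(2) by (simp_all add: bij_def surj_f_inv_f)
  have inv_lin: "linear (inv j)"
  proof (rule linearI)
    show "inv j (u + v) = inv j u + inv j v" for u v
      using inv_j[of "inv j u + inv j v"] by (simp add: j_simps del: inv_j)
    show "inv j (c *\<^sub>R u) = c *\<^sub>R inv j u" for c u
      using inv_j[of "c *\<^sub>R inv j u"] by (simp add: j_simps del: inv_j)
  qed
  note inv_simps = linear_add[OF inv_lin] linear_diff[OF inv_lin] linear_neg[OF inv_lin]
    linear_scale[OF inv_lin] linear_0[OF inv_lin]
  \<comment> \<open>Non-degeneracy in the second argument follows from the first: \<open>v\<close>
    and \<open>u\<close> are moved to the base by \<open>inv j\<close>, where symmetry exchanges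
    them.\<close>
  have nondeg': "v = 0" if "\<And>x. W x v = 0" for v
  proof -
    have "W (inv j v) u = 0" for u
      using sym[of "inv j v" "inv j u"] that by simp
    then have "inv j v = 0" by (rule nondeg)
    then show "v = 0" by (metis j_inv linear_0[OF j(1)])
  qed
  \<comment> \<open>In this form the two facts say that each summand equals its own orthogonal
    complement, as \<open>lagrangian\<close> demands.\<close>
  have null: "(\<forall>x. W x v = 0) \<longleftrightarrow> v = 0" "(\<forall>v. W x v = 0) \<longleftrightarrow> x = 0" for x v
    using nondeg nondeg' by (metis W_simps(10), metis W_simps(9))
  \<comment> \<open>The cocycle condition solved for the bracket; integrability then becomes a
    formal identity between terms \<open>inv j (\<rho> x (j y))\<close>.\<close>
  have br_eq: "br x y = inv j (\<rho> x (j y)) - inv j (\<rho> y (j x))" for x y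
    using inv_j[of "br x y"] by (simp add: j_cocycle inv_simps del: inv_j)
  interpret total: lie_algebra ?br by (rule lie_algebra_semidirect)
  have "symplectic_lie_algebra ?br ?\<omega>"
  proof
    show "bilinear ?\<omega>"
      unfolding bilinear_def by (auto intro!: linearI simp: W_simps algebra_simps)
    show "?\<omega> x x = 0" for x by (cases x) simp
    show "x = 0" if *: "\<And>y. ?\<omega> x y = 0" for x
    proof (cases x)
      case (Pair a u)
      have "a = 0"
        by (rule nondeg) (use *[of "(0, v)" for v] Pair in \<open>simp add: W_simps\<close>)
      moreover have "u = 0"
        by (rule nondeg') (use *[of "(y, 0)" for y] Pair in \<open>simp add: W_simps\<close>)
      ultimately show ?thesis using Pair by (simp add: zero_prod_def)
    qed
    show "ce_differential ?br ?\<omega> x y z = 0" for x y z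
      by (cases x; cases y; cases z)
        (simp add: ce_differential_def semidirect_def W_cocycle W_simps)
  qed
  moreover have "complex_lie_algebra ?br ?J"
  proof (intro complex_lie_algebra.intro complex_lie_algebra_axioms.intro)
    show "lie_algebra ?br" ..
    show "linear ?J"
      by (auto intro!: linearI simp: inv_simps j_simps)
    show "?J (?J x) = - x" for x
      by (cases x) (simp add: j_simps inv_simps)
    show "?br x y - ?br (?J x) (?J y) + ?J (?br x (?J y) + ?br (?J x) y) = 0" for x y
    proof -
      \<comment> \<open>In these coordinates J is simply (a, j p) -> (-p, j a), so no
        \<open>inv j\<close> acts on an arbitrary fibre vector.\<close>
      obtain a p b q where "x = (a, j p)" "y = (b, j q)"
        by (metis j_inv surj_pair)
      then show ?thesis
        by (simp add: semidirect_def bilinear_simps inv_simps j_simps zero_prod_def br_eq)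
    qed
  qed
  moreover have "?\<omega> (?J x) (?J y) = ?\<omega> x y" for x y
  proof -
    obtain a p b q where "x = (a, j p)" "y = (b, j q)"
      by (metis j_inv surj_pair)
    then show ?thesis
      by (simp add: W_simps sym[of q a] sym[of p b])
  qed
  ultimately have "pseudo_kaehler ?br ?\<omega> ?J"
    by (simp add: pseudo_kaehler_def pseudo_kaehler_axioms_def)
  moreover have "?J ` (UNIV \<times> {0}) = {0} \<times> UNIV"
    by (force simp: inv_simps image_iff intro: j_inv[symmetric])
  moreover have "lagrangian ?\<omega> (UNIV \<times> {0})"
    by (auto simp: lagrangian_def W_simps null intro!: subspace_Times)
  moreover have "lagrangian ?\<omega> ({0} \<times> UNIV)"
    by (auto simp: lagrangian_def W_simps null intro!: subspace_Times)
  ultimately show ?thesis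
    by (simp add: special_lagrangian_def special_lagrangian_axioms_def lie_representation_axioms)
qed

end

section \<open>The cocycles of a given special Lagrangian structure\<close>

context special_lagrangian
begin

definition "J_map x = snd (J (x, 0))"

text \<open>The mixed block of \<open>\<omega>\<close>, which determines the whole form because both
  summands are Lagrangian.\<close>

definition "pairing x v = \<omega> (x, 0) (0, v)"

lemma J_base: "J (x, 0) = (0, J_map x)"
proof -
  have "J (x, 0) \<in> {0} \<times> UNIV" using J_image by blast
  then show ?thesis by (auto simp: J_map_def)
qed

lemma J_fibre: "J (0, J_map x) = (- x, 0)"
  using total.J_square[of "(x, 0)"] by (simp add: J_base)

lemma linear_J_map: "linear J_map"
proof -
  have "linear (\<lambda>x. J (x, 0))"
    by (rule linear_compose[OF _ total.J_linear, unfolded o_def]) (auto intro: linearI)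
  then show ?thesis
    unfolding J_map_def by (rule linear_compose[OF _ linear_snd, unfolded o_def])
qed

lemma bij_J_map: "bij J_map"
proof (rule bijI)
  show "inj J_map"
    using J_fibre by (metis injI neg_equal_iff_equal prod.inject)
  show "surj J_map"
  proof (rule surjI)
    fix v
    have "(0, v) \<in> J ` (UNIV \<times> {0})" using J_image by simp
    then obtain x where "J_map x = v" by (auto simp: J_base)
    then show "J_map (SOME x. J_map x = v) = v" by (rule someI)
  qed
qed

lemma bilinear_pairing: "bilinear pairing"
proof -
  have *: "linear (\<lambda>x. \<omega> x y)" "linear (\<omega> x)" for x y
    using total.form_bilinear unfolding bilinear_def by blast+
  have "linear (\<lambda>x. (x, 0))" "linear (\<lambda>v. (0, v))"
    by (auto intro: linearI)
  then have "linear (\<lambda>x. \<omega> (x, 0) y)" "linear (\<lambda>v. \<omega> z (0, v))" for y z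
    using linear_compose[OF _ *(1)] linear_compose[OF _ *(2)] unfolding o_def by blast+
  then show ?thesis by (simp add: bilinear_def pairing_def)
qed

lemma form_base: "\<omega> (x, 0) (y, 0) = 0"
  and form_fibre: "\<omega> (0, u) (0, v) = 0"
  using lagrangian_base lagrangian_fibre by (auto simp: lagrangian_def)

lemma form_antisym: "\<omega> x y = - \<omega> y x"
  using total.form_alternating[of "x + y"] total.form_alternating[of x] total.form_alternating[of y]
  by (simp add: bilinear_ladd[OF total.form_bilinear] bilinear_radd[OF total.form_bilinear])

text \<open>Compatibility is applied to one base and one fibre vector; J exchanges the summands, and
  antisymmetry absorbs the sign from \<open>J_fibre\<close>.\<close>

lemma pairing_sym: "pairing x (J_map y) = pairing y (J_map x)"
proof -
  have "\<omega> (x, 0) (0, J_map y) = \<omega> (0, J_map x) (- y, 0)"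
    using total.compatible[of "(x, 0)" "(0, J_map y)"] by (simp add: J_base J_fibre)
  also have "\<dots> = - \<omega> (0, J_map x) (y, 0)"
    using bilinear_rneg[OF total.form_bilinear, of _ "(y, 0)"] by simp
  also have "\<dots> = \<omega> (y, 0) (0, J_map x)"
    by (simp add: form_antisym[of "(y, 0)"])
  finally show ?thesis by (simp add: pairing_def)
qed

lemma pairing_nondegenerate:
  assumes "\<And>v. pairing x v = 0"
  shows "x = 0"
proof -
  have "\<omega> (x, 0) (y, v) = 0" for y v
    using bilinear_radd[OF total.form_bilinear, of "(x, 0)" "(y, 0)" "(0, v)"] assms
    by (simp add: form_base pairing_def)
  then have "(x, 0 :: 'v) = 0"
    by (intro total.nondegenerate) auto
  then show ?thesis by (simp add: zero_prod_def)
qed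

text \<open>Integrability on two base vectors: the term [Jx, Jy] vanishes because the fibre is
  abelian, and the remaining mixed brackets add up to a fibre vector \<open>w\<close>.\<close>

lemma J_map_cocycle: "J_map (br x y) = \<rho> x (J_map y) - \<rho> y (J_map x)"
proof -
  define w where "w = \<rho> x (J_map y) - \<rho> y (J_map x)"
  have "(br x y, 0) + J (0, w) = 0"
    using total.integrable[of "(x, 0)" "(y, 0)"]
    by (simp add: J_base semidirect_def bilinear_simps w_def)
  \<comment> \<open>With \<open>w = J_map z\<close>, \<open>J (0, w)\<close> is
    \<open>(- z, 0)\<close>, so the equation forces \<open>br x y = z\<close>.\<close>
  moreover obtain z where "w = J_map z"
    using bij_J_map by (metis bij_pointE)
  ultimately show ?thesis by (simp add: J_fibre zero_prod_def flip: w_def)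
qed

text \<open>Closedness on two base vectors and one fibre vector.\<close>

lemma pairing_cocycle: "pairing (br x y) u = pairing x (\<rho> y u) - pairing y (\<rho> x u)"
  using total.closed[of "(x, 0)" "(y, 0)" "(0, u)"]
    form_antisym[of "(0, \<rho> x u)"] form_antisym[of "(0, \<rho> y u)"]
  by (simp add: ce_differential_def semidirect_def bilinear_simps pairing_def)

lemma form_map_apply: "dual_apply (form_map \<omega> x) v = pairing x v"
  using bilinear_pairing by (simp add: form_map_def bilinear_def dual_apply_Dual flip: pairing_def)

lemma linear_form_map: "linear (form_map \<omega>)"
  by (intro linearI dual_eqI)
    (simp_all add: form_map_apply dual_apply_simps bilinear_ladd[OF bilinear_pairing]
      bilinear_lmul[OF bilinear_pairing])

text \<open>Injectivity is non-degeneracy of the pairing. For surjectivity the pairing is pulled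
  back along \<open>J_map\<close> to a bilinear form on the Lie algebra alone, where functionals are
  represented.\<close>

lemma bij_form_map: "bij (form_map \<omega>)"
proof (rule bijI)
  show "inj (form_map \<omega>)"
    unfolding linear_injective_0[OF linear_form_map]
    by (metis form_map_apply pairing_nondegenerate zero_dual_space.rep_eq)
  have "\<exists>x. form_map \<omega> x = a" for a
  proof -
    have *: "bilinear (\<lambda>x y. pairing x (J_map y))"
      using bilinear_pairing linear_compose[OF linear_J_map]
      by (auto simp: bilinear_def o_def)
    have surj: "\<exists>y. v = J_map y" for v
      using bij_J_map by (metis bij_pointE)
    have nondeg: "x = 0" if "\<And>y. pairing x (J_map y) = 0" for x
      using that surj by (intro pairing_nondegenerate) metis
    have lin: "linear (\<lambda>y. dual_apply a (J_map y))"
      using linear_compose[OF linear_J_map dual_apply_linear] by (simp add: o_def)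
    obtain x where "\<And>y. pairing x (J_map y) = dual_apply a (J_map y)"
      using nondegenerate_form_represents[OF finite_dim * nondeg lin] by blast
    then have "form_map \<omega> x = a"
      by (intro dual_eqI) (metis form_map_apply surj)
    then show ?thesis ..
  qed
  then show "surj (form_map \<omega>)" by (metis surjI)
qed

text \<open>\<open>special_lagrangianI\<close> is applied with \<open>form_map \<omega>\<close> as
  \<open>j\<close> and evaluation at \<open>J_map x\<close> as \<open>W\<close>, so each hypothesis
  is a property of the original structure with the two cocycles exchanged.\<close>

lemma dual_special_lagrangian:
  "special_lagrangian br (dual_rep \<rho>) (omega_J J) (J_omega \<omega>)"
proof -
  interpret dual: lie_representation br "dual_rep \<rho>"
    using bij_form_map linear_form_map finite_dim
    by (intro dual_lie_representation finite_dim_linear_surj[of "form_map \<omega>"]) (auto simp: bij_def)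
  have "special_lagrangian br (dual_rep \<rho>)
      (\<lambda>(x, u) (y, v). dual_apply v (J_map x) - dual_apply u (J_map y))
      (\<lambda>(x, u). (- inv (form_map \<omega>) u, form_map \<omega> x))"
  proof (rule dual.special_lagrangianI[OF linear_form_map bij_form_map])
    show "bilinear (\<lambda>x a. dual_apply a (J_map x))"
      using linear_compose[OF linear_J_map dual_apply_linear]
      by (auto simp: bilinear_def o_def dual_apply_simps intro!: linearI)
    show "dual_apply (form_map \<omega> y) (J_map x) = dual_apply (form_map \<omega> x) (J_map y)" for x y
      by (simp add: form_map_apply pairing_sym)
    \<comment> \<open>Functionals of the form \<open>form_map \<omega> y\<close> suffice as tests:
      by symmetry, their values at \<open>J_map x\<close> are the pairings of \<open>x\<close> with
      \<open>J_map y\<close>.\<close>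
    show "x = 0" if "\<And>a. dual_apply a (J_map x) = 0" for x
    proof (rule pairing_nondegenerate)
      fix v
      obtain y where "v = J_map y" using bij_J_map by (metis bij_pointE)
      then show "pairing x v = 0"
        using that[of "form_map \<omega> y"] by (simp add: form_map_apply pairing_sym)
    qed
    show "form_map \<omega> (br x y)
        = dual_rep \<rho> x (form_map \<omega> y) - dual_rep \<rho> y (form_map \<omega> x)" for x y
      by (rule dual_eqI)
        (simp add: dual_rep_apply dual_apply_simps form_map_apply pairing_cocycle)
    show "dual_apply a (J_map (br x y))
        = dual_apply (dual_rep \<rho> y a) (J_map x) - dual_apply (dual_rep \<rho> x a) (J_map y)" for x y a
      by (simp add: J_map_cocycle dual_rep_apply linear_diff[OF dual_apply_linear])
  qed
  then show ?thesis
    by (simp add: omega_J_def J_omega_def J_map_def)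
qed

end

theorem proposition3p10:
  fixes br :: "'g::real_vector \<Rightarrow> 'g \<Rightarrow> 'g"
    and \<rho> :: "'g \<Rightarrow> 'v::real_vector \<Rightarrow> 'v"
    and \<omega> :: "'g \<times> 'v \<Rightarrow> 'g \<times> 'v \<Rightarrow> real"
    and J :: "'g \<times> 'v \<Rightarrow> 'g \<times> 'v"
  assumes "special_lagrangian br \<rho> \<omega> J"
  shows "special_lagrangian br (dual_rep \<rho>) (omega_J J) (J_omega \<omega>)"
  using assms by (rule special_lagrangian.dual_special_lagrangian)

end
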